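(* Let $t$ be an indeterminate, and let $F_n^{(a)}(q)$ ($n\ge 0$) be the $q$-Fibonacci numbers with parameter $a$. For every integer $n\ge 0$, $$1+\sum_{k=1}^n t^{k-1} \left( q^{a+k-1}F^{(a)}_{k-1}(q) +(t-1)F^{(a)}_{k+1}(q)\right) =t^nF^{(a)}_{n+1}(q).$$
   Context: The $q$-Fibonacci numbers with parameter $a$ are defined by $F_0^{(a)}(q)=0$, $F_1^{(a)}(q)=1$, and $F_{n+2}^{(a)}(q) = F_{n+1}^{(a)}(q) + q^{a+n} F_n^{(a)}(q)$ for $n\ge 0$. Here $q$ is a nonzero complex number (or an indeterminate), and $q^{a+m}$ means $q^a\cdot q^m$ for a fixed nonzero value $q^a$. Empty sums equal $0$. *)

theory Defs
  imports "HOL-Computational_Algebra.Polynomial"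
begin

text \<open>
  The argument \<open>qa\<close> is the chosen nonzero value of \<open>q\<^sup>a\<close>, so that \<open>q\<^sup>a\<^sup>+\<^sup>m\<close> is
  \<open>qa * q ^ m\<close>. The coefficients lie in an arbitrary field: the complex numbers when \<open>q\<close> is a
  number, or a field of rational functions when \<open>q\<close> (and possibly \<open>q\<^sup>a\<close>) is an indeterminate.
\<close>

fun qfib :: "'a::field \<Rightarrow> 'a \<Rightarrow> nat \<Rightarrow> 'a" where
  "qfib q qa 0 = 0"
| "qfib q qa (Suc 0) = 1"
| "qfib q qa (Suc (Suc n)) = qfib q qa (Suc n) + qa * q ^ n * qfib q qa n"

end

theory Submission
  imports Defs
begin

text \<open>The sum telescopes: the recurrence gives
  \<open>qa * q ^ (k - 1) * qfib q qa (k - 1)\<close> as F_{k+1} - F_k, so the k-th summand is t^k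
  F_{k+1} - t^(k-1) F_k, and the leading 1 is t^0 F_1. Induction on \<open>n\<close> carries this
  out.\<close>

theorem mainTheorem10:
  fixes q qa :: "'a::field" and t :: "'a poly" and n :: nat
  assumes "q \<noteq> 0" and "qa \<noteq> 0"
    and "t = [:0, 1:]"
  shows "1 + (\<Sum>k=1..n. t ^ (k - 1) *
             ([:qa * q ^ (k - 1) * qfib q qa (k - 1):] + (t - 1) * [:qfib q qa (k + 1):]))
         = t ^ n * [:qfib q qa (n + 1):]"
proof (induction n)
  case 0
  show ?case by (simp add: one_pCons)
next
  case (Suc n)
  have split: "[:qfib q qa (Suc n + 1):]
      = [:qfib q qa (n + 1):] + [:qa * q ^ n * qfib q qa n:]"
    by simp
  have "1 + (\<Sum>k=1..Suc n. t ^ (k - 1) *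
             ([:qa * q ^ (k - 1) * qfib q qa (k - 1):] + (t - 1) * [:qfib q qa (k + 1):]))
      = t ^ n * [:qfib q qa (n + 1):]
        + t ^ n * ([:qa * q ^ n * qfib q qa n:] + (t - 1) * [:qfib q qa (Suc n + 1):])"
    \<comment> \<open>\<open>qfib.simps\<close> stays folded so that the sum for \<open>n\<close>
      still matches the induction hypothesis.\<close>
    using Suc.IH by (simp del: qfib.simps add: add.assoc [symmetric])
  also have "\<dots> = t ^ n * (([:qfib q qa (n + 1):] + [:qa * q ^ n * qfib q qa n:])
      + (t - 1) * [:qfib q qa (Suc n + 1):])"
    by (simp only: distrib_left add.assoc)
  \<comment> \<open>By \<open>split\<close> the inner bracket is F_{n+2}, and F_{n+2} + (t - 1)
    F_{n+2} = t F_{n+2} supplies the extra power of \<open>t\<close>.\<close>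
  also have "\<dots> = t ^ Suc n * [:qfib q qa (Suc n + 1):]"
    unfolding split [symmetric] by (simp only: power_Suc left_diff_distrib mult_1_left add_diff_cancel_left' add_diff_eq mult_ac)
  finally show ?case .
qed

end
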